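(* There exist universal constants $c_1,c_2,c_3>0$ such that the following holds. Let $n\in\mathbb{N}$, let $k\in\mathbb{N}$ be even, and let $0<p<1$. Let $N=np(1-p)-1$ and assume $k\le c_1\cdot N$. Let $a_1,\dots,a_{k/2}\in\{0,1,\dots,n-1\}$ satisfy $a_i\ne a_j$ and $a_i\ne a_j+1$ for all $i\ne j$, and let $$f(x)=\prod_{i=1}^{k/2}(x-a_i)(x-a_i-1),\qquad g(x)=\prod_{i=1}^{k/2}(x-a_i)^2 .$$ Then $$\mathbb{E}_{n,p}[g]\le c_3\,k\cdot\exp\left(c_2\cdot\frac{k}{V(N/k)}\right)\mathbb{E}_{n,p}[f],$$ where $V(a)=\exp\left(\sqrt{\log(a)\,\log\log(a)}\right)$.
   Context: $\mathbb{N}$ denotes the positive integers and $\log$ the natural logarithm. For a polynomial $\varphi$, $\mathbb{E}_{n,p}[\varphi]=\mathbb{E}[\varphi(X)]$ where $X$ has the Binomial distribution with parameters $n$ and $p$. *)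

theory Defs
  imports
    "HOL-Probability.Probability"
    "HOL-Computational_Algebra.Polynomial"
begin

definition binom_expectation :: "nat \<Rightarrow> real \<Rightarrow> real poly \<Rightarrow> real" where
  "binom_expectation n p \<phi> =
     measure_pmf.expectation (binomial_pmf n p) (\<lambda>x. poly \<phi> (real x))"

(* The nested logarithm makes mathematical sense only for a > 1, and V is used only for
   arguments a \<ge> 1 / c with c > 0 a constant that may be chosen small. For a < exp 1 the
   radicand may be negative or involve the library's value of ln at nonpositive arguments. *)
definition V :: "real \<Rightarrow> real" where
  "V a = exp (sqrt (ln a * ln (ln a)))"

end

theory Submission
  imports Defs
begin

text \<open>
  Let \<open>A = {a\<^sub>1, \<dots>, a\<^bsub>k/2\<^esub>}\<close>, let \<open>Z = A \<union> (A + 1)\<close> be the zero set of \<open>f\<close>, of size \<open>k\<close>, and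
  let \<open>G = {0, \<dots>, n} - Z\<close>. At an integer outside \<open>A + 1\<close> the value of \<open>g\<close> exceeds that of
  \<open>f\<close> by a factor of order \<open>\<surd>k\<close> at most, because the points of \<open>A\<close> are at least \<open>2\<close> apart
  (\<open>prod_squares_le_prod_abs\<close>). The difficulty is the mass that \<open>g\<close> has on \<open>A + 1\<close>, where \<open>f\<close>
  vanishes.

  The idea is to let the binomial coefficient cancel the zeros of \<open>f\<close>. Since
  \<open>x! (n - x)!\<close> is the product of the distances from \<open>x\<close> to all other points of \<open>{0, \<dots>, n}\<close>, the
  probability of \<open>x\<close> times the distances from \<open>x\<close> to the other points of \<open>Z\<close> is, up to a factor
  independent of \<open>x\<close>,
  \[ w(x) = t^x / \prod_{y \in G, y \neq x} |x - y|, \qquad t = p / (1 - p). \]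
  On \<open>G\<close> these are exactly the terms of the expectation of \<open>f\<close>. As the logarithm is
  concave, \<open>w\<close> is log-convex between two neighbouring points of \<open>G\<close>. So it obeys a maximum
  principle: the value at a point of \<open>Z\<close> is controlled by the values on \<open>G\<close>, in the form
  \[ w(x) \le \sum_{y \in G} w(y) / |x - y| \qquad (x \in Z) \]
  (\<open>barycentric_weight_le_sum\<close>). Beyond the least or greatest point of \<open>G\<close>, where there is only one
  neighbour, the same bound holds because \<open>k\<close> is small against the variance
  (\<open>prod_shift_dominates_power\<close>).

  Summing over \<open>x \<in> A + 1\<close> and using that the sum of \<open>1 / |x - y|\<close> over \<open>k/2\<close> distinct integers
  \<open>x \<noteq> y\<close> is of order at most \<open>\<surd>k\<close> bounds the expectation of \<open>g\<close> by \<open>15/2 \<cdot> k\<close> times that of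
  \<open>f\<close>. This is at most the claimed bound, since \<open>V\<close> is positive and the exponential factor
  therefore at least \<open>1\<close>.
\<close>

section \<open>Extremal sums and products over sets of positive integers\<close>

text \<open>
  The bounds below are proved by adding the elements of a set in increasing order. All summands and
  factors decrease, so a lower bound on the greatest element, the one added last, gives the
  induction step.
\<close>

lemma card_le_if_less:
  fixes A :: "nat set"
  assumes "0 \<notin> insert b A" "\<forall>a\<in>A. a < b"
  shows "Suc (card A) \<le> b"
proof -
  have "A \<subseteq> {1..<b}"
    using assms by (auto simp: Suc_le_eq) (metis gr0I)
  from card_mono[OF _ this] have "card A \<le> b - 1" by simp
  moreover have "b > 0" using assms(1) by (cases b) auto
  ultimately show ?thesis by simp
qed

lemma prod_one_plus_inverse_le:
  fixes E :: "nat set"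
  assumes "finite E" "0 \<notin> E"
  shows "(\<Prod>e\<in>E. 1 + 1 / real e) \<le> real (card E) + 1"
  using assms
proof (induction E rule: finite_linorder_max_induct)
  case empty
  then show ?case by simp
next
  case (insert b A)
  let ?m = "card A"
  have "b \<notin> A" using insert by auto
  have b: "real ?m + 1 \<le> real b"
    using card_le_if_less[of b A] insert by simp
  have "(\<Prod>e\<in>insert b A. 1 + 1 / real e) = (1 + 1 / real b) * (\<Prod>e\<in>A. 1 + 1 / real e)"
    using insert \<open>b \<notin> A\<close> by simp
  also have "\<dots> \<le> (1 + 1 / (real ?m + 1)) * (real ?m + 1)"
    using insert b by (intro mult_mono add_mono divide_left_mono prod_nonneg) auto
  also have "\<dots> = real (card (insert b A)) + 1"
    using insert \<open>b \<notin> A\<close> by (simp add: field_simps)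
  finally show ?case .
qed

text \<open>
  The harmonic sum is only logarithmic, but the square root has a short induction step and, next to
  the factor of order \<open>\<surd>k\<close> lost in comparing \<open>g\<close> with \<open>f\<close>, still gives a bound linear in \<open>k\<close>.
\<close>

lemma sum_inverse_le_sqrt_card:
  fixes E :: "nat set"
  assumes "finite E" "0 \<notin> E"
  shows "(\<Sum>e\<in>E. 1 / real e) \<le> 2 * sqrt (real (card E))"
  using assms
proof (induction E rule: finite_linorder_max_induct)
  case empty
  then show ?case by simp
next
  case (insert b A)
  let ?m = "real (card A)"
  have "b \<notin> A" using insert by auto
  have b: "?m + 1 \<le> real b"
    using card_le_if_less[of b A] insert by simp
  define u v where "u = sqrt ?m" and "v = sqrt (?m + 1)"
  have uv: "0 \<le> u" "u \<le> v" "v \<ge> 1" "v * v = u * u + 1" "?m + 1 = v * v"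
    by (simp_all add: u_def v_def)
  have "1 = (v - u) * (v + u)" using uv(4) by (simp add: algebra_simps)
  also have "\<dots> \<le> (v - u) * (2 * v)" using uv by (intro mult_left_mono) auto
  finally have "1 / v \<le> 2 * v - 2 * u" using uv by (simp add: field_simps)
  moreover have "1 / (v * v) \<le> 1 / v" using \<open>v \<ge> 1\<close> by (simp add: divide_simps)
  ultimately have step: "1 / (?m + 1) + 2 * u \<le> 2 * v"
    unfolding \<open>?m + 1 = v * v\<close> by linarith
  have "(\<Sum>e\<in>insert b A. 1 / real e) = 1 / real b + (\<Sum>e\<in>A. 1 / real e)"
    using insert \<open>b \<notin> A\<close> by simp
  also have "\<dots> \<le> 1 / (?m + 1) + 2 * u"
    using insert b by (intro add_mono divide_left_mono) (auto simp: u_def)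
  also note step
  finally show ?case
    using insert \<open>b \<notin> A\<close> by (simp add: v_def add.commute)
qed

text \<open>
  A set without consecutive elements has at least \<open>2 m + 1\<close> as its \<open>(m + 1)\<close>-st element, so the
  extremal product is \<open>2/1 \<cdot> 4/3 \<cdot> 6/5 \<cdots>\<close>, which grows like the square root of its length. The form
  \<open>4 m + 1\<close> of the bound on its square is chosen so that it passes from \<open>m\<close> to \<open>m + 1\<close>: the step
  reduces to \<open>(2 m + 2)\<^sup>2 (4 m + 1) \<le> (4 m + 5) (2 m + 1)\<^sup>2\<close>, whose sides differ by \<open>1\<close>.
\<close>

lemma prod_one_plus_inverse_squared_le:
  fixes E :: "nat set"
  assumes "finite E" "0 \<notin> E" "\<And>e. e \<in> E \<Longrightarrow> Suc e \<notin> E"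
  shows "(\<Prod>e\<in>E. 1 + 1 / real e)\<^sup>2 \<le> 4 * real (card E) + 1"
  using assms
proof (induction E rule: finite_linorder_max_induct)
  case empty
  then show ?case by simp
next
  case (insert b A)
  define m where "m = real (card A)"
  have "b \<notin> A" using insert by auto
  have "A \<inter> Suc ` A = {}" using insert.prems by auto
  then have "card (A \<union> Suc ` A) = 2 * card A"
    using insert by (simp add: card_Un_disjoint card_image)
  moreover have "Suc a \<noteq> b" if "a \<in> A" for a
    using insert.prems that by blast
  then have "\<forall>a\<in>A \<union> Suc ` A. a < b"
    using insert.hyps by (auto intro: Suc_lessI)
  moreover have "0 \<notin> insert b (A \<union> Suc ` A)" using insert.prems by auto
  ultimately have "Suc (2 * card A) \<le> b"
    using card_le_if_less[of b "A \<union> Suc ` A"] by simp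
  then have b: "2 * m + 1 \<le> real b" unfolding m_def by linarith
  have IH: "(\<Prod>e\<in>A. 1 + 1 / real e)\<^sup>2 \<le> 4 * m + 1"
    unfolding m_def using insert by blast
  have "m \<ge> 0" by (simp add: m_def)
  have "(\<Prod>e\<in>insert b A. 1 + 1 / real e)\<^sup>2
      = (1 + 1 / real b)\<^sup>2 * (\<Prod>e\<in>A. 1 + 1 / real e)\<^sup>2"
    using insert.hyps \<open>b \<notin> A\<close> by (simp add: power_mult_distrib)
  also have "\<dots> \<le> (1 + 1 / (2 * m + 1))\<^sup>2 * (4 * m + 1)"
    using IH b \<open>m \<ge> 0\<close> by (intro mult_mono power_mono add_mono divide_left_mono) auto
  also have "\<dots> = (2 * m + 2)\<^sup>2 * (4 * m + 1) / (2 * m + 1)\<^sup>2"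
    using \<open>m \<ge> 0\<close> by (simp add: field_simps power2_eq_square)
  also have "\<dots> \<le> 4 * m + 5"
  proof -
    have "(2 * m + 2)\<^sup>2 * (4 * m + 1) \<le> (4 * m + 5) * (2 * m + 1)\<^sup>2"
      using \<open>m \<ge> 0\<close> by (simp add: algebra_simps power2_eq_square power3_eq_cube)
    then show ?thesis using \<open>m \<ge> 0\<close> by (simp add: field_simps)
  qed
  finally show ?case
    using insert.hyps \<open>b \<notin> A\<close> by (simp add: m_def)
qed

text \<open>
  This is the estimate for points outside the range of the nodes. Moving the set one step further
  multiplies the product by \<open>1 + 1/e\<close> for each of its elements \<open>e\<close>. Over all of \<open>{1..n}\<close> these
  factors telescope to \<open>n + 1\<close>, and the at most \<open>k\<close> missing ones account for at most \<open>k + 1\<close>, so each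
  step gains at least \<open>(n + 1) / (k + 1) \<ge> s\<close>.
\<close>

lemma prod_shift_dominates_power:
  fixes D :: "nat set" and s :: real
  assumes "D \<subseteq> {1..m}" "n \<le> card D + k" "m + j \<le> n" "0 \<le> s" "s * real (k + 1) \<le> real (n + 1)"
  shows "s ^ j * (\<Prod>d\<in>D. real d) \<le> (\<Prod>d\<in>D. real (d + j))"
  using assms(3)
proof (induction j)
  case 0
  then show ?case by simp
next
  case (Suc j)
  have finD: "finite D" using assms(1) finite_subset by blast
  define E where "E = (\<lambda>d. d + j) ` D"
  define C where "C = {1..n} - E"
  have E: "E \<subseteq> {1..n}" unfolding E_def using assms(1) Suc.prems by auto
  then have finE: "finite E" using finite_subset by blast
  have "card E = card D" unfolding E_def by (intro card_image inj_onI) simp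
  then have C: "finite C" "0 \<notin> C" "card C \<le> k"
    using E finE assms(2) by (auto simp: C_def card_Diff_subset)
  have tel: "(\<Prod>e=1..n. 1 + 1 / real e) = real n + 1"
    by (induction n) (auto simp: prod.atLeast_Suc_atMost_Suc_shift field_simps)
  have "real n + 1 = (\<Prod>e\<in>C. 1 + 1 / real e) * (\<Prod>e\<in>E. 1 + 1 / real e)"
    unfolding tel[symmetric] C_def by (rule prod.subset_diff) (use E in auto)
  also have "\<dots> \<le> real (k + 1) * (\<Prod>e\<in>E. 1 + 1 / real e)"
    using prod_one_plus_inverse_le[of C] C by (intro mult_right_mono prod_nonneg) auto
  finally have "real n + 1 \<le> (\<Prod>e\<in>E. 1 + 1 / real e) * real (k + 1)"
    by (simp only: mult.commute)
  moreover have "s * real (k + 1) \<le> real n + 1" using assms(5) by simp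
  ultimately have "s * real (k + 1) \<le> (\<Prod>e\<in>E. 1 + 1 / real e) * real (k + 1)"
    by (rule order_trans[rotated])
  then have s: "s \<le> (\<Prod>e\<in>E. 1 + 1 / real e)"
    by (rule mult_right_le_imp_le) simp
  have "s * (\<Prod>e\<in>E. real e) \<le> (\<Prod>e\<in>E. 1 + 1 / real e) * (\<Prod>e\<in>E. real e)"
    using s by (intro mult_right_mono prod_nonneg) auto
  also have "\<dots> = (\<Prod>e\<in>E. real e + 1)"
    unfolding prod.distrib[symmetric] by (rule prod.cong) (use E in \<open>auto simp: field_simps\<close>)
  finally have step: "s * (\<Prod>d\<in>D. real (d + j)) \<le> (\<Prod>d\<in>D. real (d + Suc j))"
    by (simp add: E_def prod.reindex inj_on_def add_ac)
  have "s ^ Suc j * (\<Prod>d\<in>D. real d) = s * (s ^ j * (\<Prod>d\<in>D. real d))" by simp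
  also have "\<dots> \<le> s * (\<Prod>d\<in>D. real (d + j))"
    using Suc assms(4) by (intro mult_left_mono) auto
  also note step
  finally show ?case .
qed

text \<open>The distances to the points on one side of \<open>y\<close> are distinct positive integers.\<close>

lemma sum_inverse_distance_le:
  fixes S :: "nat set" and y :: nat
  assumes "finite S" "y \<notin> S"
  shows "(\<Sum>x\<in>S. 1 / \<bar>real x - real y\<bar>) \<le> 4 * sqrt (real (card S))"
proof -
  define L R where "L = {x\<in>S. x < y}" and "R = {x\<in>S. y < x}"
  have fin: "finite L" "finite R" using assms by (auto simp: L_def R_def)
  have S: "S = L \<union> R" and disj: "L \<inter> R = {}"
    using assms by (auto simp: L_def R_def) (metis nat_neq_iff)
  have "(\<Sum>x\<in>L. 1 / \<bar>real x - real y\<bar>) = (\<Sum>e\<in>(\<lambda>x. y - x) ` L. 1 / real e)"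
    by (subst sum.reindex) (auto simp: L_def inj_on_def of_nat_diff)
  also have "\<dots> \<le> 2 * sqrt (real (card ((\<lambda>x. y - x) ` L)))"
    using fin by (intro sum_inverse_le_sqrt_card) (auto simp: L_def)
  also have "\<dots> \<le> 2 * sqrt (real (card S))"
    using assms card_image_le[OF fin(1), of "\<lambda>x. y - x"] card_mono[of S L] by (auto simp: S)
  finally have left: "(\<Sum>x\<in>L. 1 / \<bar>real x - real y\<bar>) \<le> 2 * sqrt (real (card S))" .
  have "(\<Sum>x\<in>R. 1 / \<bar>real x - real y\<bar>) = (\<Sum>e\<in>(\<lambda>x. x - y) ` R. 1 / real e)"
    by (subst sum.reindex) (auto simp: R_def inj_on_def of_nat_diff)
  also have "\<dots> \<le> 2 * sqrt (real (card ((\<lambda>x. x - y) ` R)))"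
    using fin by (intro sum_inverse_le_sqrt_card) (auto simp: R_def)
  also have "\<dots> \<le> 2 * sqrt (real (card S))"
    using assms card_image_le[OF fin(2), of "\<lambda>x. x - y"] card_mono[of S R] by (auto simp: S)
  finally have right: "(\<Sum>x\<in>R. 1 / \<bar>real x - real y\<bar>) \<le> 2 * sqrt (real (card S))" .
  have "(\<Sum>x\<in>S. 1 / \<bar>real x - real y\<bar>)
      = (\<Sum>x\<in>L. 1 / \<bar>real x - real y\<bar>) + (\<Sum>x\<in>R. 1 / \<bar>real x - real y\<bar>)"
    unfolding S by (rule sum.union_disjoint) (use fin disj in auto)
  with left right show ?thesis by simp
qed

section \<open>A maximum principle for barycentric weights\<close>

text \<open>
  For \<open>x \<in> G\<close> this is, up to sign and the numerator \<open>t ^ x\<close>, the barycentric weight of the node \<open>x\<close>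
  in Lagrange interpolation at \<open>G\<close>. The same formula is used off \<open>G\<close>, where no factor is left out.
\<close>

definition barycentric_weight :: "real \<Rightarrow> nat set \<Rightarrow> nat \<Rightarrow> real" where
  "barycentric_weight t G x = t ^ x / (\<Prod>y\<in>G - {x}. \<bar>real x - real y\<bar>)"

lemma barycentric_weight_nonneg: "0 < t \<Longrightarrow> 0 \<le> barycentric_weight t G x"
  by (simp add: barycentric_weight_def prod_nonneg)

text \<open>
  With the factors of the two neighbouring nodes \<open>y0\<close> and \<open>y1\<close> removed, the weight is \<open>exp \<circ> W\<close> for a
  function \<open>W\<close> that is convex on \<open>[y0, y1]\<close>, so \<open>exp \<circ> W\<close> lies below its chord. Restoring the
  factors \<open>1 / ((x - y0) (y1 - x))\<close> at \<open>x\<close> and \<open>1 / (y1 - y0)\<close> at the nodes turns the chord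
  into the right-hand side.
\<close>

lemma barycentric_weight_between:
  assumes "finite G" "0 < t" "y0 \<in> G" "y1 \<in> G" "y0 < x" "x < y1"
    and gap: "\<And>y. y \<in> G \<Longrightarrow> y \<le> y0 \<or> y1 \<le> y"
  shows "barycentric_weight t G x
    \<le> barycentric_weight t G y0 / (real x - real y0) + barycentric_weight t G y1 / (real y1 - real x)"
proof -
  define R where "R = G - {y0, y1}"
  define W where "W u = real u * ln t - (\<Sum>y\<in>R. ln \<bar>real u - real y\<bar>)" for u :: nat
  define \<mu> where "\<mu> = (real x - real y0) / (real y1 - real y0)"
  have finR: "finite R" using assms by (simp add: R_def)
  have \<mu>: "0 \<le> \<mu>" "\<mu> \<le> 1" using assms by (auto simp: \<mu>_def)
  have \<mu>x: "real x = (1 - \<mu>) * real y0 + \<mu> * real y1"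
  proof -
    have "\<mu> * (real y1 - real y0) = real x - real y0" using assms by (simp add: \<mu>_def)
    then show ?thesis by (simp add: algebra_simps)
  qed
  have away: "y < y0 \<or> y1 < y" if "y \<in> R" for y
    using gap[of y] that by (auto simp: R_def)
  have expW: "exp (W u) = t ^ u / (\<Prod>y\<in>R. \<bar>real u - real y\<bar>)" if "y0 \<le> u" "u \<le> y1" for u
  proof -
    have "exp (\<Sum>y\<in>R. ln \<bar>real u - real y\<bar>) = (\<Prod>y\<in>R. \<bar>real u - real y\<bar>)"
      unfolding exp_sum[OF finR]
      by (rule prod.cong) (use away that in \<open>force intro!: exp_ln\<close>)+
    moreover have "exp (real u * ln t) = t ^ u"
      using assms by (simp add: exp_of_nat_mult)
    ultimately show ?thesis by (simp add: W_def exp_diff)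
  qed
  \<comment> \<open>Each remaining node lies outside the interval, so the distance to it is affine there.\<close>
  have logs: "(1 - \<mu>) * ln \<bar>real y0 - real y\<bar> + \<mu> * ln \<bar>real y1 - real y\<bar> \<le> ln \<bar>real x - real y\<bar>"
    if "y \<in> R" for y
  proof -
    have "\<bar>real x - real y\<bar> = (1 - \<mu>) * \<bar>real y0 - real y\<bar> + \<mu> * \<bar>real y1 - real y\<bar>"
      using away[OF that]
    proof
      assume "y < y0"
      then show ?thesis using assms \<mu>x by (simp add: algebra_simps)
    next
      assume "y1 < y"
      then show ?thesis using assms \<mu>x by (simp add: algebra_simps)
    qed
    moreover have "\<bar>real y0 - real y\<bar> > 0" "\<bar>real y1 - real y\<bar> > 0"
      using away[OF that] assms by auto
    ultimately show ?thesis
      using convex_onD[OF ln_concave[unfolded concave_on_def], of \<mu> "\<bar>real y0 - real y\<bar>" "\<bar>real y1 - real y\<bar>"] \<mu>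
      by simp
  qed
  have "(\<Sum>y\<in>R. (1 - \<mu>) * ln \<bar>real y0 - real y\<bar> + \<mu> * ln \<bar>real y1 - real y\<bar>)
      \<le> (\<Sum>y\<in>R. ln \<bar>real x - real y\<bar>)"
    by (rule sum_mono) (rule logs)
  then have "(1 - \<mu>) * (\<Sum>y\<in>R. ln \<bar>real y0 - real y\<bar>) + \<mu> * (\<Sum>y\<in>R. ln \<bar>real y1 - real y\<bar>)
      \<le> (\<Sum>y\<in>R. ln \<bar>real x - real y\<bar>)"
    by (simp add: sum.distrib sum_distrib_left)
  moreover have "real x * ln t = (1 - \<mu>) * (real y0 * ln t) + \<mu> * (real y1 * ln t)"
    unfolding \<mu>x by (simp add: algebra_simps)
  ultimately have "W x \<le> (1 - \<mu>) * W y0 + \<mu> * W y1"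
    unfolding W_def right_diff_distrib by linarith
  then have "exp (W x) \<le> exp ((1 - \<mu>) * W y0 + \<mu> * W y1)" by simp
  also have "\<dots> \<le> (1 - \<mu>) * exp (W y0) + \<mu> * exp (W y1)"
    using convex_onD[OF convex_on_exp[of 1], of \<mu> "W y0" "W y1"] \<mu> by simp
  finally have main: "exp (W x) \<le> (1 - \<mu>) * exp (W y0) + \<mu> * exp (W y1)" .
  let ?l = "real x - real y0" and ?r = "real y1 - real x"
  have pos: "?l > 0" "?r > 0" using assms by auto
  have notin: "y0 \<notin> R" "y1 \<notin> R" by (auto simp: R_def)
  have wx: "barycentric_weight t G x = exp (W x) / (?l * ?r)"
  proof -
    have "G - {x} = insert y0 (insert y1 R)"
      using assms gap[of x] by (auto simp: R_def)
    then have "(\<Prod>y\<in>G - {x}. \<bar>real x - real y\<bar>) = (?l * ?r) * (\<Prod>y\<in>R. \<bar>real x - real y\<bar>)"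
      using pos finR notin by simp
    then show ?thesis
      using pos by (simp add: barycentric_weight_def expW)
  qed
  have wy0: "barycentric_weight t G y0 = exp (W y0) / (?l + ?r)"
  proof -
    have "G - {y0} = insert y1 R" using assms by (auto simp: R_def)
    then have "(\<Prod>y\<in>G - {y0}. \<bar>real y0 - real y\<bar>) = (?l + ?r) * (\<Prod>y\<in>R. \<bar>real y0 - real y\<bar>)"
      using pos finR notin by simp
    then show ?thesis
      using pos by (simp add: barycentric_weight_def expW)
  qed
  have wy1: "barycentric_weight t G y1 = exp (W y1) / (?l + ?r)"
  proof -
    have "G - {y1} = insert y0 R" using assms by (auto simp: R_def)
    then have "(\<Prod>y\<in>G - {y1}. \<bar>real y1 - real y\<bar>) = (?l + ?r) * (\<Prod>y\<in>R. \<bar>real y1 - real y\<bar>)"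
      using pos finR notin by simp
    then show ?thesis
      using pos by (simp add: barycentric_weight_def expW)
  qed
  have \<mu>_eq: "\<mu> = ?l / (?l + ?r)" by (simp add: \<mu>_def)
  have \<mu>': "1 - \<mu> = ?r / (?l + ?r)"
    unfolding \<mu>_eq using pos by (simp add: divide_simps)
  have "barycentric_weight t G x \<le> ((1 - \<mu>) * exp (W y0) + \<mu> * exp (W y1)) / (?l * ?r)"
    unfolding wx using main pos by (intro divide_right_mono) auto
  also have "\<dots> = barycentric_weight t G y0 / ?l + barycentric_weight t G y1 / ?r"
    unfolding wy0 wy1 \<mu>' unfolding \<mu>_eq using pos by (simp add: add_divide_distrib)
  finally show ?thesis .
qed

text \<open>
  The mirror-image cases of a point left and right of all nodes, in common terms: \<open>y1\<close> is the
  extreme node, \<open>d\<close> gives the distance to it, and \<open>x\<close> lies \<open>j\<close> steps beyond it. The step factor \<open>s\<close>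
  is \<open>1 / t\<close> on the left and \<open>t\<close> on the right.
\<close>

lemma barycentric_weight_beyond_extreme:
  fixes d :: "nat \<Rightarrow> nat"
  assumes "finite G" "y1 \<in> G" "x \<notin> G" "0 < t" "0 < j"
    and d: "inj_on d (G - {y1})" "d ` (G - {y1}) \<subseteq> {1..m}" "m + j \<le> n" "n + 1 \<le> card G + k"
    and dist: "\<bar>real x - real y1\<bar> = real j"
      "\<And>y. y \<in> G - {y1} \<Longrightarrow> \<bar>real y1 - real y\<bar> = real (d y)"
      "\<And>y. y \<in> G - {y1} \<Longrightarrow> \<bar>real x - real y\<bar> = real (d y + j)"
    and s: "0 \<le> s" "t ^ x = s ^ j * t ^ y1" "s * real (k + 1) \<le> real (n + 1)"
  shows "barycentric_weight t G x \<le> barycentric_weight t G y1 / \<bar>real x - real y1\<bar>"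
proof -
  define D where "D = d ` (G - {y1})"
  have "card D = card G - 1"
    unfolding D_def using d(1) assms by (simp add: card_image)
  moreover have "card G > 0" using assms by (auto simp: card_gt_0_iff)
  ultimately have "n \<le> card D + k" using d(4) by linarith
  then have dom: "s ^ j * (\<Prod>e\<in>D. real e) \<le> (\<Prod>e\<in>D. real (e + j))"
    using d s prod_shift_dominates_power[of D m n k j s] by (simp add: D_def)
  have pos: "(\<Prod>e\<in>D. real e) > 0" "(\<Prod>e\<in>D. real (e + j)) > 0"
    using d(2) assms(5) by (force simp: D_def intro!: prod_pos)+
  have "(\<Prod>y\<in>G - {y1}. \<bar>real y1 - real y\<bar>) = (\<Prod>e\<in>D. real e)"
    unfolding D_def prod.reindex[OF d(1)] by (rule prod.cong) (use dist in auto)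
  then have wy: "barycentric_weight t G y1 = t ^ y1 / (\<Prod>e\<in>D. real e)"
    by (simp add: barycentric_weight_def)
  have "(\<Prod>y\<in>G - {x}. \<bar>real x - real y\<bar>) = real j * (\<Prod>y\<in>G - {y1}. \<bar>real x - real y\<bar>)"
    using assms(1-3) dist(1) by (simp add: prod.remove[of G y1])
  also have "(\<Prod>y\<in>G - {y1}. \<bar>real x - real y\<bar>) = (\<Prod>e\<in>D. real (e + j))"
    unfolding D_def prod.reindex[OF d(1)] by (rule prod.cong) (use dist in auto)
  finally have wx: "barycentric_weight t G x = s ^ j * t ^ y1 / (real j * (\<Prod>e\<in>D. real (e + j)))"
    by (simp add: barycentric_weight_def s(2))
  have "s ^ j / (\<Prod>e\<in>D. real (e + j)) \<le> 1 / (\<Prod>e\<in>D. real e)"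
    using dom pos by (simp add: divide_simps)
  then have "(s ^ j / (\<Prod>e\<in>D. real (e + j))) * (t ^ y1 / real j) \<le> (1 / (\<Prod>e\<in>D. real e)) * (t ^ y1 / real j)"
    using assms by (intro mult_right_mono) auto
  then show ?thesis by (simp add: wx wy dist(1) mult_ac)
qed

text \<open>
  A point of the complement is controlled by its two neighbouring nodes, or by the only one if it
  lies beyond an extreme node. The bound is nevertheless stated with all nodes, so that the sums over
  \<open>x\<close> and \<open>y\<close> can be interchanged when many points \<open>x\<close> are treated at once.
\<close>

lemma barycentric_weight_le_sum:
  assumes G: "G \<subseteq> {..n}" "G \<noteq> {}" "n + 1 \<le> card G + k"
    and t: "0 < t" "real (k + 1) \<le> t * real (n + 1)" "t * real (k + 1) \<le> real (n + 1)"
    and x: "x \<le> n" "x \<notin> G"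
  shows "barycentric_weight t G x \<le> (\<Sum>y\<in>G. barycentric_weight t G y / \<bar>real x - real y\<bar>)"
proof -
  have finG: "finite G" using G(1) finite_subset by blast
  let ?q = "\<lambda>y. barycentric_weight t G y / \<bar>real x - real y\<bar>"
  have nonneg: "?q y \<ge> 0" for y using barycentric_weight_nonneg[OF t(1)] by simp
  have single: "?q y \<le> (\<Sum>y\<in>G. ?q y)" if "y \<in> G" for y
    using that finG nonneg by (intro member_le_sum) auto
  define L R where "L = {y\<in>G. y < x}" and "R = {y\<in>G. x < y}"
  have fin: "finite L" "finite R" and LR: "G = L \<union> R"
    using finG x(2) by (auto simp: L_def R_def) (metis nat_neq_iff)
  consider "L = {}" | "R = {}" | "L \<noteq> {}" "R \<noteq> {}" by blast
  then show ?thesis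
  proof cases
    case 1
    define y1 where "y1 = Min G"
    have y1: "y1 \<in> G" "\<And>y. y \<in> G \<Longrightarrow> y1 \<le> y"
      using finG G by (auto simp: y1_def)
    have "x < y1" using 1 LR y1(1) by (auto simp: R_def)
    have "y1 \<le> n" using y1 G by auto
    have lt: "y1 < y" if "y \<in> G - {y1}" for y
      using y1(2)[of y] that by auto
    have "barycentric_weight t G x \<le> ?q y1"
    proof (rule barycentric_weight_beyond_extreme[where d = "\<lambda>y. y - y1" and m = "n - y1"
          and j = "y1 - x" and s = "1 / t" and n = n and k = k])
      show "inj_on (\<lambda>y. y - y1) (G - {y1})"
        using y1(2) by (intro inj_onI) (metis DiffD1 eq_diff_iff)
      show "(\<lambda>y. y - y1) ` (G - {y1}) \<subseteq> {1..n - y1}"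
        using lt G(1) by force
      show "t ^ x = (1 / t) ^ (y1 - x) * t ^ y1"
        using \<open>x < y1\<close> t(1) by (simp add: power_diff field_simps)
      show "1 / t * real (k + 1) \<le> real (n + 1)"
        using t by (simp add: field_simps)
      show "\<bar>real x - real y\<bar> = real (y - y1 + (y1 - x))" if "y \<in> G - {y1}" for y
        using lt[OF that] \<open>x < y1\<close> by linarith
    qed (use finG y1 x t G \<open>x < y1\<close> \<open>y1 \<le> n\<close> lt in \<open>auto simp: of_nat_diff less_imp_le\<close>)
    with single[OF y1(1)] show ?thesis by linarith
  next
    case 2
    define y1 where "y1 = Max G"
    have y1: "y1 \<in> G" "\<And>y. y \<in> G \<Longrightarrow> y \<le> y1"
      using finG G by (auto simp: y1_def)
    have "y1 < x" using 2 LR y1(1) by (auto simp: L_def)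
    have lt: "y < y1" if "y \<in> G - {y1}" for y
      using y1(2)[of y] that by auto
    have "barycentric_weight t G x \<le> ?q y1"
    proof (rule barycentric_weight_beyond_extreme[where d = "\<lambda>y. y1 - y" and m = y1
          and j = "x - y1" and s = t and n = n and k = k])
      show "inj_on (\<lambda>y. y1 - y) (G - {y1})"
        using y1(2) by (intro inj_onI) (metis DiffD1 diff_diff_cancel)
      show "(\<lambda>y. y1 - y) ` (G - {y1}) \<subseteq> {1..y1}"
        using lt by force
      show "t ^ x = t ^ (x - y1) * t ^ y1"
        using \<open>y1 < x\<close> by (simp flip: power_add)
      show "\<bar>real x - real y\<bar> = real (y1 - y + (x - y1))" if "y \<in> G - {y1}" for y
        using lt[OF that] \<open>y1 < x\<close> by linarith
    qed (use finG y1 x t G \<open>y1 < x\<close> lt in \<open>auto simp: of_nat_diff less_imp_le\<close>)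
    with single[OF y1(1)] show ?thesis by linarith
  next
    case 3
    define y0 y1 where "y0 = Max L" and "y1 = Min R"
    have "y0 \<in> L" "y1 \<in> R" using fin 3 by (auto simp: y0_def y1_def)
    then have y: "y0 \<in> G" "y1 \<in> G" "y0 < x" "x < y1" by (auto simp: L_def R_def)
    have gap: "y \<le> y0 \<or> y1 \<le> y" if "y \<in> G" for y
      using that fin unfolding y0_def y1_def LR by auto
    have "barycentric_weight t G x \<le> ?q y0 + ?q y1"
      using barycentric_weight_between[OF finG t(1) y gap] y by simp
    also have "\<dots> = (\<Sum>y\<in>{y0, y1}. ?q y)" using y by simp
    also have "\<dots> \<le> (\<Sum>y\<in>G. ?q y)"
      using y finG nonneg by (intro sum_mono2) auto
    finally show ?thesis .
  qed
qed

lemma fact_eq_binomial_times_distances: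
  assumes "x \<le> n"
  shows "real (n choose x) * (\<Prod>z\<in>{..n} - {x}. \<bar>real x - real z\<bar>) = fact n"
proof -
  have split: "{..n} - {x} = {..<x} \<union> {x<..n}" and disj: "{..<x} \<inter> {x<..n} = {}"
    using assms by auto
  have left: "(\<Prod>z<x. \<bar>real x - real z\<bar>) = fact x"
  proof -
    have "(\<Prod>z<x. \<bar>real x - real z\<bar>) = (\<Prod>i=1..x. real i)"
      by (rule prod.reindex_bij_witness[of _ "\<lambda>i. x - i" "\<lambda>z. x - z"]) (auto simp: of_nat_diff)
    then show ?thesis by (simp add: fact_prod)
  qed
  have right: "(\<Prod>z\<in>{x<..n}. \<bar>real x - real z\<bar>) = fact (n - x)"
  proof -
    have "(\<Prod>z\<in>{x<..n}. \<bar>real x - real z\<bar>) = (\<Prod>i=1..n - x. real i)"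
      by (rule prod.reindex_bij_witness[of _ "\<lambda>i. x + i" "\<lambda>z. z - x"]) (auto simp: of_nat_diff)
    then show ?thesis by (simp add: fact_prod)
  qed
  have "(\<Prod>z\<in>{..n} - {x}. \<bar>real x - real z\<bar>) = fact x * fact (n - x)"
    unfolding split left[symmetric] right[symmetric] by (rule prod.union_disjoint) (use disj in auto)
  then show ?thesis
    using binomial_fact[OF assms, where 'a = real] by (simp add: field_simps)
qed

section \<open>Comparing the two polynomials under the binomial distribution\<close>

text \<open>
  On the right-hand side \<open>x\<close> itself is left out of the zeros, so that the bound also covers \<open>x \<in> A + 1\<close>; the
  factor \<open>\<bar>x - a\<bar>\<close> with \<open>a + 1 = x\<close> on the left is \<open>1\<close>. The remaining quotients
  \<open>\<bar>x - a\<bar> / \<bar>x - a - 1\<bar>\<close> are below \<open>1\<close> for \<open>a > x\<close> and equal to \<open>1 + 1/d\<close> with \<open>d = x - a - 1\<close> for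
  \<open>a + 1 < x\<close>. These \<open>d\<close> are positive and never consecutive.
\<close>

lemma prod_squares_le_prod_abs:
  fixes A :: "nat set"
  assumes A: "finite A" "\<And>a. a \<in> A \<Longrightarrow> Suc a \<notin> A" and x: "x \<notin> A"
  shows "(\<Prod>a\<in>A. (real x - real a)\<^sup>2)
    \<le> sqrt (4 * real (card A) + 1) * (\<Prod>z\<in>A \<union> Suc ` A - {x}. \<bar>real x - real z\<bar>)"
proof -
  define B where "B = {a\<in>A. Suc a \<noteq> x}"
  define L where "L = {a\<in>A. Suc a < x}"
  define D where "D = (\<lambda>a. x - Suc a) ` L"
  have fin: "finite B" "finite L" "finite D" using A by (auto simp: B_def L_def D_def)
  have "A \<union> Suc ` A - {x} = A \<union> Suc ` B" using x by (auto simp: B_def)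
  moreover have "A \<inter> Suc ` B = {}" using A by (auto simp: B_def)
  ultimately have zeros: "(\<Prod>z\<in>A \<union> Suc ` A - {x}. \<bar>real x - real z\<bar>)
      = (\<Prod>a\<in>A. \<bar>real x - real a\<bar>) * (\<Prod>a\<in>B. \<bar>real x - real (Suc a)\<bar>)"
    using A fin by (simp add: prod.union_disjoint prod.reindex)
  have drop: "(\<Prod>a\<in>A. \<bar>real x - real a\<bar>) = (\<Prod>a\<in>B. \<bar>real x - real a\<bar>)"
    using A by (intro prod.mono_neutral_right) (auto simp: B_def)
  have "(\<Prod>d\<in>D. 1 + 1 / real d)\<^sup>2 \<le> 4 * real (card D) + 1"
  proof (rule prod_one_plus_inverse_squared_le)
    fix e assume "e \<in> D"
    then obtain a where a: "a \<in> A" "Suc a < x" "e = x - Suc a" by (auto simp: D_def L_def)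
    show "Suc e \<notin> D"
    proof
      assume "Suc e \<in> D"
      then obtain b where b: "b \<in> A" "Suc b < x" "Suc e = x - Suc b" by (auto simp: D_def L_def)
      then have "a = Suc b" using a by linarith
      then show False using A(2) a b by blast
    qed
  qed (use fin in \<open>auto simp: D_def L_def\<close>)
  also have "card D \<le> card A"
    unfolding D_def using card_image_le[OF fin(2)] card_mono[of A L] A
    by (metis (no_types, lifting) L_def le_trans mem_Collect_eq subsetI)
  finally have "(\<Prod>d\<in>D. 1 + 1 / real d) \<le> sqrt (4 * real (card A) + 1)"
    by (intro real_le_rsqrt) simp
  moreover have "(\<Prod>d\<in>D. 1 + 1 / real d) = (\<Prod>a\<in>L. 1 + 1 / real (x - Suc a))"
    unfolding D_def by (subst prod.reindex) (auto simp: inj_on_def L_def)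
  moreover have "\<dots> = (\<Prod>a\<in>B. if Suc a < x then 1 + 1 / real (x - Suc a) else 1)"
    using A by (intro prod.mono_neutral_cong_left) (auto simp: B_def L_def)
  ultimately have ratio: "(\<Prod>a\<in>B. if Suc a < x then 1 + 1 / real (x - Suc a) else 1)
      \<le> sqrt (4 * real (card A) + 1)" by simp
  have "(\<Prod>a\<in>B. \<bar>real x - real a\<bar>)
      \<le> (\<Prod>a\<in>B. (if Suc a < x then 1 + 1 / real (x - Suc a) else 1) * \<bar>real x - real (Suc a)\<bar>)"
  proof (rule prod_mono, intro conjI)
    fix a assume "a \<in> B"
    then have "Suc a < x \<or> x < a" using x by (auto simp: B_def) (metis not_less_eq nat_neq_iff)
    then show "\<bar>real x - real a\<bar>
        \<le> (if Suc a < x then 1 + 1 / real (x - Suc a) else 1) * \<bar>real x - real (Suc a)\<bar>"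
      by (auto simp: of_nat_diff field_simps)
  qed simp
  also have "\<dots> \<le> sqrt (4 * real (card A) + 1) * (\<Prod>a\<in>B. \<bar>real x - real (Suc a)\<bar>)"
    unfolding prod.distrib by (intro mult_right_mono ratio prod_nonneg) auto
  finally have main: "(\<Prod>a\<in>A. \<bar>real x - real a\<bar>)
      \<le> sqrt (4 * real (card A) + 1) * (\<Prod>a\<in>B. \<bar>real x - real (Suc a)\<bar>)"
    unfolding drop .
  have "(\<Prod>a\<in>A. (real x - real a)\<^sup>2) = (\<Prod>a\<in>A. \<bar>real x - real a\<bar>) * (\<Prod>a\<in>A. \<bar>real x - real a\<bar>)"
    by (simp add: power2_eq_square flip: prod.distrib)
  also have "\<dots> \<le> (\<Prod>a\<in>A. \<bar>real x - real a\<bar>)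
      * (sqrt (4 * real (card A) + 1) * (\<Prod>a\<in>B. \<bar>real x - real (Suc a)\<bar>))"
    by (intro mult_left_mono main prod_nonneg) auto
  finally show ?thesis by (simp add: zeros mult_ac)
qed

text \<open>
  The distances to \<open>Z\<close> cancel against those hidden in the factorials of the binomial coefficient,
  which leaves only the distances to the complement of \<open>Z\<close> in the denominator.
\<close>

lemma binomial_prob_times_distances_eq:
  assumes "0 < p" "p < 1" "Z \<subseteq> {..n}" "x \<le> n"
  shows "real (n choose x) * p ^ x * (1 - p) ^ (n - x) * (\<Prod>z\<in>Z - {x}. \<bar>real x - real z\<bar>)
    = fact n * (1 - p) ^ n * barycentric_weight (p / (1 - p)) ({..n} - Z) x"
proof -
  let ?G = "{..n} - Z"
  have finZ: "finite Z" using assms(3) finite_subset by blast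
  have "{..n} - {x} = (Z - {x}) \<union> (?G - {x})" using assms(3) by auto
  then have "(\<Prod>z\<in>{..n} - {x}. \<bar>real x - real z\<bar>)
      = (\<Prod>z\<in>Z - {x}. \<bar>real x - real z\<bar>) * (\<Prod>z\<in>?G - {x}. \<bar>real x - real z\<bar>)"
    using finZ by (simp add: prod.union_disjoint[symmetric] disjoint_iff)
  with fact_eq_binomial_times_distances[OF assms(4)]
  have "fact n = real (n choose x) * (\<Prod>z\<in>Z - {x}. \<bar>real x - real z\<bar>) * (\<Prod>z\<in>?G - {x}. \<bar>real x - real z\<bar>)"
    by (simp add: mult.assoc)
  moreover have "(\<Prod>z\<in>?G - {x}. \<bar>real x - real z\<bar>) \<noteq> 0" by simp
  ultimately have "real (n choose x) * (\<Prod>z\<in>Z - {x}. \<bar>real x - real z\<bar>)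
      = fact n / (\<Prod>z\<in>?G - {x}. \<bar>real x - real z\<bar>)"
    by (simp add: field_simps)
  moreover have "p ^ x * (1 - p) ^ (n - x) = (1 - p) ^ n * (p / (1 - p)) ^ x"
    using assms by (simp add: power_diff power_divide)
  moreover have "real (n choose x) * p ^ x * (1 - p) ^ (n - x) * (\<Prod>z\<in>Z - {x}. \<bar>real x - real z\<bar>)
      = (p ^ x * (1 - p) ^ (n - x)) * (real (n choose x) * (\<Prod>z\<in>Z - {x}. \<bar>real x - real z\<bar>))"
    by (simp only: mult_ac)
  ultimately show ?thesis
    by (simp only: barycentric_weight_def) simp
qed

text \<open>
  The terms of the sum of squares vanish on \<open>A\<close>. Those on \<open>G\<close> are comparable with the terms on the
  right, and those on \<open>A + 1\<close> are distributed over \<open>G\<close> by the maximum principle.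
\<close>

lemma sum_squares_le_sum_adjacent_products:
  fixes A :: "nat set" and p :: real
  defines "P \<equiv> \<lambda>n x. real (n choose x) * p ^ x * (1 - p) ^ (n - x)"
  assumes p: "0 < p" "p < 1" and A: "A \<subseteq> {..<n}" "\<And>a. a \<in> A \<Longrightarrow> Suc a \<notin> A"
    and var: "real (2 * card A + 1) \<le> real n * p * (1 - p)"
  shows "(\<Sum>x\<le>n. P n x * (\<Prod>a\<in>A. (real x - real a)\<^sup>2))
    \<le> sqrt (4 * real (card A) + 1) * (1 + 4 * sqrt (real (card A)))
        * (\<Sum>x\<le>n. P n x * (\<Prod>a\<in>A. (real x - real a) * (real x - real a - 1)))"
proof -
  define Z where "Z = A \<union> Suc ` A"
  define G where "G = {..n} - Z"
  define M where "M x = P n x * (\<Prod>z\<in>Z - {x}. \<bar>real x - real z\<bar>)" for x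
  define t where "t = p / (1 - p)"
  let ?B = "sqrt (4 * real (card A) + 1)" and ?S = "Suc ` A"
  have finA: "finite A" using A(1) finite_subset by blast
  have Z: "Z \<subseteq> {..n}" and finZ: "finite Z" using A(1) finA by (auto simp: Z_def)
  have "A \<inter> Suc ` A = {}" using A(2) by auto
  then have cardZ: "card Z = 2 * card A"
    using finA by (simp add: Z_def card_Un_disjoint card_image)
  have cardG: "card G = n + 1 - 2 * card A"
    unfolding G_def using card_Diff_subset[OF finZ Z] cardZ by simp
  have P: "P n x \<ge> 0" for x using p by (simp add: P_def)

  have M: "M x = fact n * (1 - p) ^ n * barycentric_weight t G x" if "x \<le> n" for x
    unfolding M_def P_def t_def G_def using binomial_prob_times_distances_eq[OF p Z that] .
  have M_nonneg: "M x \<ge> 0" for x by (simp add: M_def P prod_nonneg)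
  have M_le_sum: "M x \<le> (\<Sum>y\<in>G. M y / \<bar>real x - real y\<bar>)" if "x \<in> Z" for x
  proof -
    have "real n * p * (1 - p) \<le> real n * p * 1" using p by (intro mult_left_mono) auto
    moreover have "real n * (1 - p) * p \<le> real n * (1 - p) * 1" using p by (intro mult_left_mono) auto
    ultimately have np: "real (2 * card A + 1) \<le> real n * p" "real (2 * card A + 1) \<le> real n * (1 - p)"
      using var by (auto simp: mult_ac)
    have "real n * p \<le> real n * 1" using p by (intro mult_left_mono) auto
    then have "card G > 0" using np(1) unfolding cardG by linarith
    then have "G \<noteq> {}" by auto
    have odds: "real (2 * card A + 1) * (1 - p) \<le> real (n + 1) * p"
      "real (2 * card A + 1) * p \<le> real (n + 1) * (1 - p)"
    proof -
      have "real (2 * card A + 1) * (1 - p) \<le> real (2 * card A + 1) * 1"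
        "real (2 * card A + 1) * p \<le> real (2 * card A + 1) * 1"
        using p by (intro mult_left_mono; simp)+
      then show "real (2 * card A + 1) * (1 - p) \<le> real (n + 1) * p"
        "real (2 * card A + 1) * p \<le> real (n + 1) * (1 - p)"
        using np p by (auto simp: distrib_right)
    qed
    have x: "x \<le> n" "x \<notin> G" using that Z by (auto simp: G_def)
    have "barycentric_weight t G x \<le> (\<Sum>y\<in>G. barycentric_weight t G y / \<bar>real x - real y\<bar>)"
    proof (rule barycentric_weight_le_sum[where n = n and k = "2 * card A"])
      show "0 < t" using p by (simp add: t_def)
      show "real (2 * card A + 1) \<le> t * real (n + 1)"
        using odds(1) p by (simp add: t_def field_simps)
      show "t * real (2 * card A + 1) \<le> real (n + 1)"
        using odds(2) p by (simp add: t_def field_simps)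
    qed (use \<open>G \<noteq> {}\<close> cardG x in \<open>auto simp: G_def\<close>)
    then have "fact n * (1 - p) ^ n * barycentric_weight t G x
        \<le> fact n * (1 - p) ^ n * (\<Sum>y\<in>G. barycentric_weight t G y / \<bar>real x - real y\<bar>)"
      using p by (intro mult_left_mono) auto
    then show ?thesis
      using x M by (simp add: sum_distrib_left G_def)
  qed

  have f: "(\<Sum>x\<le>n. P n x * (\<Prod>a\<in>A. (real x - real a) * (real x - real a - 1))) = (\<Sum>y\<in>G. M y)"
  proof (rule sum.mono_neutral_cong_right)
    show "\<forall>x\<in>{..n} - G. P n x * (\<Prod>a\<in>A. (real x - real a) * (real x - real a - 1)) = 0"
      using finA by (auto simp: G_def Z_def)
    fix y assume "y \<in> G"
    then have y: "y \<notin> A" "y \<notin> Suc ` A" by (auto simp: G_def Z_def)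
    have "(\<Prod>a\<in>A. (real y - real a) * (real y - real a - 1))
        = (\<Prod>a\<in>A. \<bar>real y - real a\<bar> * \<bar>real y - real (Suc a)\<bar>)"
    proof (rule prod.cong[OF refl])
      fix a assume "a \<in> A"
      have "(real y - real a) * (real y - real a - 1) \<ge> 0"
        by (cases "y \<le> a") (auto intro!: mult_nonneg_nonneg mult_nonpos_nonpos)
      then have "(real y - real a) * (real y - real a - 1) = \<bar>(real y - real a) * (real y - real a - 1)\<bar>"
        by simp
      then show "(real y - real a) * (real y - real a - 1) = \<bar>real y - real a\<bar> * \<bar>real y - real (Suc a)\<bar>"
        by (simp add: abs_mult diff_diff_eq add.commute)
    qed
    also have "\<dots> = (\<Prod>z\<in>Z - {y}. \<bar>real y - real z\<bar>)"
      using y finA \<open>A \<inter> Suc ` A = {}\<close> by (simp add: Z_def prod.union_disjoint prod.reindex prod.distrib)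
    finally show "P n y * (\<Prod>a\<in>A. (real y - real a) * (real y - real a - 1)) = M y"
      by (simp add: M_def)
  qed (auto simp: G_def)

  have "(\<Sum>x\<le>n. P n x * (\<Prod>a\<in>A. (real x - real a)\<^sup>2)) = (\<Sum>x\<in>G \<union> ?S. P n x * (\<Prod>a\<in>A. (real x - real a)\<^sup>2))"
    using A finA by (intro sum.mono_neutral_right) (auto simp: G_def Z_def)
  also have "\<dots> \<le> (\<Sum>x\<in>G \<union> ?S. ?B * M x)"
  proof (rule sum_mono)
    fix x assume "x \<in> G \<union> ?S"
    then have "x \<notin> A" using A by (auto simp: G_def Z_def)
    from prod_squares_le_prod_abs[OF finA A(2) this]
    show "P n x * (\<Prod>a\<in>A. (real x - real a)\<^sup>2) \<le> ?B * M x"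
      using mult_left_mono[OF _ P[of x]] by (fastforce simp: M_def Z_def mult_ac)
  qed
  also have "\<dots> = ?B * ((\<Sum>x\<in>G. M x) + (\<Sum>x\<in>?S. M x))"
    unfolding sum_distrib_left[symmetric]
    by (subst sum.union_disjoint) (use finA in \<open>auto simp: G_def Z_def\<close>)
  also have "\<dots> \<le> ?B * ((\<Sum>x\<in>G. M x) + (\<Sum>x\<in>?S. \<Sum>y\<in>G. M y / \<bar>real x - real y\<bar>))"
    by (intro mult_left_mono add_left_mono sum_mono M_le_sum) (auto simp: Z_def)
  also have "\<dots> = ?B * ((\<Sum>y\<in>G. M y) + (\<Sum>y\<in>G. M y * (\<Sum>x\<in>?S. 1 / \<bar>real x - real y\<bar>)))"
    by (subst sum.swap) (simp add: sum_distrib_left)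
  also have "\<dots> \<le> ?B * ((\<Sum>y\<in>G. M y) + (\<Sum>y\<in>G. M y * (4 * sqrt (real (card A)))))"
  proof (intro mult_left_mono add_left_mono sum_mono)
    fix y assume "y \<in> G"
    then show "(\<Sum>x\<in>?S. 1 / \<bar>real x - real y\<bar>) \<le> 4 * sqrt (real (card A))"
      using sum_inverse_distance_le[of ?S y] finA by (simp add: G_def Z_def card_image)
  qed (use M_nonneg in auto)
  also have "\<dots> = ?B * (1 + 4 * sqrt (real (card A))) * (\<Sum>y\<in>G. M y)"
    by (simp add: sum_distrib_right[symmetric] algebra_simps)
  finally show ?thesis unfolding f .
qed

theorem theorem4p1:
  shows "\<exists>c1 c2 c3 :: real. c1 > 0 \<and> c2 > 0 \<and> c3 > 0 \<and>
    (\<forall>(n :: nat) (k :: nat) (p :: real) (N :: real) (a :: nat \<Rightarrow> nat) (f :: real poly) (g :: real poly).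
       n \<ge> 1 \<longrightarrow> k \<ge> 1 \<longrightarrow> even k \<longrightarrow> 0 < p \<longrightarrow> p < 1 \<longrightarrow>
       N = real n * p * (1 - p) - 1 \<longrightarrow>
       real k \<le> c1 * N \<longrightarrow>
       (\<forall>i\<in>{1..k div 2}. a i \<in> {0..n - 1}) \<longrightarrow>
       (\<forall>i\<in>{1..k div 2}. \<forall>j\<in>{1..k div 2}. i \<noteq> j \<longrightarrow> a i \<noteq> a j \<and> a i \<noteq> a j + 1) \<longrightarrow>
       f = (\<Prod>i=1..k div 2. [:- real (a i), 1:] * [:- real (a i) - 1, 1:]) \<longrightarrow>
       g = (\<Prod>i=1..k div 2. [:- real (a i), 1:] ^ 2) \<longrightarrow>
       binom_expectation n p g
         \<le> c3 * real k * exp (c2 * (real k / V (N / real k))) * binom_expectation n p f)"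
proof -
  have bound: "binom_expectation n p g
      \<le> 15 / 2 * real k * exp (1 * (real k / V (N / real k))) * binom_expectation n p f"
    if "n \<ge> 1" "k \<ge> 1" "even k" "0 < p" "p < 1" and N: "N = real n * p * (1 - p) - 1"
      and k: "real k \<le> 1 / 2 * N"
      and range: "\<forall>i\<in>{1..k div 2}. a i \<in> {0..n - 1}"
      and sep: "\<forall>i\<in>{1..k div 2}. \<forall>j\<in>{1..k div 2}. i \<noteq> j \<longrightarrow> a i \<noteq> a j \<and> a i \<noteq> a j + 1"
      and f: "f = (\<Prod>i=1..k div 2. [:- real (a i), 1:] * [:- real (a i) - 1, 1:])"
      and g: "g = (\<Prod>i=1..k div 2. [:- real (a i), 1:] ^ 2)"
    for n k :: nat and p N :: real and a :: "nat \<Rightarrow> nat" and f g :: "real poly"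
  proof -
    define A where "A = a ` {1..k div 2}"
    have inj: "inj_on a {1..k div 2}" using sep by (auto simp: inj_on_def)
    then have "card A = k div 2" by (simp add: A_def card_image)
    then have card: "2 * card A = k" using \<open>even k\<close> by simp
    have A: "A \<subseteq> {..<n}" using range \<open>n \<ge> 1\<close> by (force simp: A_def)
    have spaced: "Suc b \<notin> A" if "b \<in> A" for b
    proof
      assume "Suc b \<in> A"
      with that obtain i j where "i \<in> {1..k div 2}" "j \<in> {1..k div 2}" "a i = Suc b" "a j = b"
        by (auto simp: A_def)
      then show False using sep by (cases "i = j") auto
    qed
    have poly_f: "poly f (real x) = (\<Prod>b\<in>A. (real x - real b) * (real x - real b - 1))" for x
      unfolding f A_def prod.reindex[OF inj] poly_prod by (intro prod.cong) (auto simp: algebra_simps)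
    have poly_g: "poly g (real x) = (\<Prod>b\<in>A. (real x - real b)\<^sup>2)" for x
      unfolding g A_def prod.reindex[OF inj] poly_prod by (intro prod.cong) (auto simp: algebra_simps)
    have E: "binom_expectation n p \<phi> = (\<Sum>x\<le>n. real (n choose x) * p ^ x * (1 - p) ^ (n - x) * poly \<phi> (real x))" for \<phi>
      unfolding binom_expectation_def using \<open>0 < p\<close> \<open>p < 1\<close> by (simp add: expectation_binomial_pmf')
    have Ef_nonneg: "binom_expectation n p f \<ge> 0"
    proof -
      have nonneg: "(real x - real b) * (real x - real b - 1) \<ge> 0" for x b
        by (cases "x \<le> b") (auto intro!: mult_nonneg_nonneg mult_nonpos_nonpos)
      then show ?thesis
        unfolding E poly_f using \<open>0 < p\<close> \<open>p < 1\<close>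
        by (intro sum_nonneg mult_nonneg_nonneg[OF _ prod_nonneg] nonneg) auto
    qed
    define u where "u = sqrt (real (card A))"
    have "k \<ge> 2" using \<open>k \<ge> 1\<close> \<open>even k\<close> by presburger
    then have u: "u \<ge> 1" "u * u = real (card A)" using card by (auto simp: u_def)
    \<comment> \<open>This is where \<open>c1 = 1/2\<close> comes from: \<open>k + 1 \<le> 2 k \<le> N\<close>.\<close>
    have "real (2 * card A + 1) \<le> real n * p * (1 - p)"
      unfolding card using k N \<open>k \<ge> 1\<close> by simp
    from sum_squares_le_sum_adjacent_products[OF \<open>0 < p\<close> \<open>p < 1\<close> A spaced this]
    have "binom_expectation n p g
        \<le> sqrt (4 * real (card A) + 1) * (1 + 4 * u) * binom_expectation n p f"
      unfolding E poly_f poly_g u_def .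
    also have "\<dots> \<le> (3 * u) * (5 * u) * binom_expectation n p f"
    proof (intro mult_right_mono mult_mono Ef_nonneg)
      have "1 * 1 \<le> u * u" using u by (intro mult_mono) auto
      then show "sqrt (4 * real (card A) + 1) \<le> 3 * u"
        using u by (intro real_le_lsqrt) (auto simp: power2_eq_square)
    qed (use u in auto)
    also have "(3 * u) * (5 * u) = 15 / 2 * real k"
      using u(2) card[symmetric] by simp
    also have "15 / 2 * real k * binom_expectation n p f
        \<le> 15 / 2 * real k * exp (1 * (real k / V (N / real k))) * binom_expectation n p f"
    proof (intro mult_right_mono Ef_nonneg)
      have "15 / 2 * real k * 1 \<le> 15 / 2 * real k * exp (1 * (real k / V (N / real k)))"
        by (intro mult_left_mono) (auto simp: V_def)
      then show "15 / 2 * real k \<le> 15 / 2 * real k * exp (1 * (real k / V (N / real k)))"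
        by simp
    qed
    finally show ?thesis .
  qed
  show ?thesis
    by (intro exI[of _ "1 / 2"] exI[of _ 1] exI[of _ "15 / 2"] conjI allI impI) (simp, simp, simp, rule bound)
qed

end
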